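(* A multiset with parameters $0<p<1$ and $m_j\ge 1$, $j\ge 1$, is convergent if and only if $\tilde g\in RT_\rho$ for some $\rho<p^{-1}$, where $\tilde g(x)=\prod_{j\ge 1}\big(1-(px)^j\big)^{-m_j}$.
   Context: A multiset with parameters $0<p<1$ and $m_j\ge 1$, $j\ge 1$, is the random structure induced by independent random variables $Z_j$, $j\ge 1$, with the negative binomial distribution $NB(m_j,p^j)$, i.e. $\mathbb{P}(Z_j=k)=(1-p^j)^{m_j}\binom{m_j+k-1}{k}p^{jk}$, $k\ge 0$: its counting process $\{\mathbf{K}^{(n)}=(K^{(n)}_1,\dots,K^{(n)}_n),\ n\ge 1\}$ is defined by $\mathcal{L}(\mathbf{K}^{(n)})=\mathcal{L}\big(Z_1,\dots,Z_n\,\big|\,\sum_{j=1}^n jZ_j=n\big)$. The random structure is said to be convergent if for each fixed $l\ge 1$ the law of $(K^{(n)}_1,\dots,K^{(n)}_l)$ converges weakly, as $n\to\infty$, to some probability law on $\mathbb{R}^l$; otherwise it is divergent. $\tilde g$ is regarded as a formal power series. For $0\le\rho\le\infty$, $RT_\rho$ is the collection of sequences $\{d_n\}$ of nonnegative numbers with $\lim_{n\to\infty}d_n/d_{n+1}=\rho$; a power series $\sum_{n}d_nx^n$ is said to be in $RT_\rho$ if $\{d_n\}\in RT_\rho$. *)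

theory Defs
  imports "HOL-Probability.Probability" "HOL-Computational_Algebra.Formal_Power_Series"
begin

text \<open>The parameter \<open>r\<close> may be any positive real, so the binomial coefficient is the
  generalised one.\<close>

definition neg_binomial_prob :: "real \<Rightarrow> real \<Rightarrow> nat \<Rightarrow> real" where
  "neg_binomial_prob r q k = (1 - q) powr r * ((r + real k - 1) gchoose k) * q ^ k"

text \<open>The law of \<open>(Z\<^sub>1, \<dots>, Z\<^sub>n)\<close> conditional on \<open>Z\<^sub>1 + 2 Z\<^sub>2 + \<dots> + n Z\<^sub>n = n\<close>. In the library,
  \<open>uniform_measure M A\<close> is \<open>M\<close> conditioned on the event \<open>A\<close>.\<close>

definition counting_law :: "'a measure \<Rightarrow> (nat \<Rightarrow> 'a \<Rightarrow> nat) \<Rightarrow> nat \<Rightarrow> (nat \<Rightarrow> nat) measure" where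
  "counting_law M Z n =
     distr (uniform_measure M {\<omega> \<in> space M. (\<Sum>j = 1..n. j * Z j \<omega>) = n})
       (\<Pi>\<^sub>M j\<in>{1..n}. count_space UNIV)
       (\<lambda>\<omega>. \<lambda>j\<in>{1..n}. Z j \<omega>)"

text \<open>\<open>\<real>\<^sup>l\<close> is rendered as \<open>\<Pi>\<^sub>M j\<in>{1..l}. borel\<close>, whose points are the functions that are
  \<open>undefined\<close> outside \<open>{1..l}\<close>. Given the law \<open>K\<close> of \<open>(K\<^sub>1, \<dots>, K\<^sub>n)\<close>, the following is the law of
  \<open>(K\<^sub>1, \<dots>, K\<^sub>l)\<close> on \<open>\<real>\<^sup>l\<close>; it is meaningful for \<open>l \<le> n\<close> only, which suffices for limits
  \<open>n \<rightarrow> \<infinity>\<close> with \<open>l\<close> fixed.\<close>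

definition marginal_law :: "nat \<Rightarrow> (nat \<Rightarrow> nat) measure \<Rightarrow> (nat \<Rightarrow> real) measure" where
  "marginal_law l K = distr K (\<Pi>\<^sub>M j\<in>{1..l}. borel) (\<lambda>k. \<lambda>j\<in>{1..l}. real (k j))"

text \<open>The library's weak convergence covers laws on \<open>\<real>\<close> only. The topology on \<open>space \<mu>\<close> is
  the subspace topology; for \<open>\<real>\<^sup>l\<close> as above (a subspace of the product topology on
  \<open>nat \<Rightarrow> real\<close>) it is the Euclidean one.\<close>

definition converges_weakly :: "(nat \<Rightarrow> 'a::topological_space measure) \<Rightarrow> 'a measure \<Rightarrow> bool" where
  "converges_weakly \<nu> \<mu> \<longleftrightarrow>
     (\<forall>f :: 'a \<Rightarrow> real. continuous_on (space \<mu>) f \<longrightarrow> bounded (f ` space \<mu>) \<longrightarrow>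
        (\<lambda>n. integral\<^sup>L (\<nu> n) f) \<longlonglongrightarrow> integral\<^sup>L \<mu> f)"

text \<open>A random structure is given by the sequence of laws of its counting process.\<close>

definition convergent_structure :: "(nat \<Rightarrow> (nat \<Rightarrow> nat) measure) \<Rightarrow> bool" where
  "convergent_structure K \<longleftrightarrow>
     (\<forall>l\<ge>1. \<exists>\<mu>. prob_space \<mu> \<and> sets \<mu> = sets (\<Pi>\<^sub>M j\<in>{1..l}. (borel :: real measure)) \<and>
        converges_weakly (\<lambda>n. marginal_law l (K n)) \<mu>)"

text \<open>That \<open>d (n + 1)\<close> is eventually nonzero is implicit in speaking of the limit of the
  quotients; it has to be spelled out since \<open>x / 0 = 0\<close> here.\<close>

definition RT :: "ennreal \<Rightarrow> (nat \<Rightarrow> real) set" where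
  "RT \<rho> = {d. (\<forall>n. 0 \<le> d n) \<and> (\<forall>\<^sub>F n in sequentially. d n \<noteq> 0) \<and>
     (\<lambda>n. ennreal (d n / d (Suc n))) \<longlonglongrightarrow> \<rho>}"

text \<open>The formal power series \<open>\<Prod>j\<ge>1. (1 - (p x)\<^sup>j) powr (- m j)\<close>; \<open>fps_binomial a\<close> is
  \<open>(1 + x) powr a\<close>, and the infinite product is taken in the coefficientwise (X-adic)
  topology on formal power series.\<close>

definition multiset_gf :: "real \<Rightarrow> (nat \<Rightarrow> real) \<Rightarrow> real fps" where
  "multiset_gf p m =
     (\<Prod>i. fps_compose (fps_binomial (- m (Suc i))) (- ((fps_const p * fps_X) ^ Suc i)))"

end

theory Submission
  imports Defs
begin

text \<open>Conditioning gives \<open>P(K\<^sub>1 = k\<^sub>1, \<dots>, K\<^sub>l = k\<^sub>l) = \<Prod>\<^sub>j a\<^sub>j(k\<^sub>j) \<cdot> [x\<^sup>n\<^sup>-\<^sup>s] e\<^sub>l / [x\<^sup>n] g\<close>, where \<open>g\<close> is the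
  generating function, \<open>s = \<Sum>\<^sub>j j k\<^sub>j\<close>, \<open>a\<^sub>j(k)\<close> is the \<open>x\<^sup>j\<^sup>k\<close>-coefficient of the \<open>j\<close>-th factor of \<open>g\<close>,
  and \<open>e\<^sub>l\<close> is \<open>g\<close> without its first \<open>l\<close> factors.

  If \<open>g \<in> RT\<^sub>\<rho>\<close> with \<open>\<rho> < 1/p\<close>, Schur's theorem on products of power series removes the factors one
  at a time, and the point masses converge to those of independent negative binomial variables with
  parameters \<open>m\<^sub>j\<close> and \<open>(p \<rho>)\<^sup>j\<close>; since the limit has total mass 1, Scheffe's lemma yields weak
  convergence.

  Conversely, \<open>l = 1\<close> suffices. The limits \<open>s\<^sub>k\<close> of \<open>[x\<^sup>n\<^sup>-\<^sup>k] e\<^sub>1 / [x\<^sup>n] g\<close> exist and, by tightness, do not all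
  vanish. Dividing the expressions for \<open>(k + 1, n + 1)\<close> and \<open>(k, n)\<close> shows that consecutive
  coefficients of \<open>g\<close> have a limiting quotient \<open>\<rho>\<close> and that \<open>s\<^sub>k = s\<^sub>0 \<rho>\<^sup>k\<close>; then
  \<open>\<Sum>\<^sub>k a\<^sub>1(k) s\<^sub>k \<le> 1\<close> and \<open>a\<^sub>1(k) \<ge> p\<^sup>k\<close> force \<open>p \<rho> < 1\<close>.\<close>

unbundle no vec_syntax and fps_syntax

section \<open>Infinite products of formal power series\<close>

text \<open>Factor \<open>F i\<close> is 1 modulo \<open>X^(i+1)\<close>, so multiplying by it
  leaves the coefficients up to index \<open>i\<close> alone and each coefficient of the partial
  products is eventually constant.\<close>

lemma prodinf_fps_nth:
  fixes F :: "nat \<Rightarrow> 'a::idom fps"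
  assumes F0: "\<And>i. F i $ 0 = 1" and F: "\<And>i n. 0 < n \<Longrightarrow> n \<le> i \<Longrightarrow> F i $ n = 0"
    and "n \<le> N"
  shows "prodinf F $ n = (\<Prod>i<N. F i) $ n"
proof -
  define P where "P N = (\<Prod>i<N. F i)" for N
  define G where "G = Abs_fps (\<lambda>n. P n $ n)"
  have step: "P (Suc N) $ n = P N $ n" if "n \<le> N" for N n
  proof -
    have "P (Suc N) $ n = (\<Sum>i=0..n. P N $ i * F N $ (n - i))"
      by (simp add: P_def fps_mult_nth)
    also have "\<dots> = (\<Sum>i=0..n. if i = n then P N $ n else 0)"
      using that by (intro sum.cong) (auto simp: F0 F)
    finally show ?thesis by simp
  qed
  have P: "P N $ n = G $ n" if "n \<le> N" for N n
    using that by (induction rule: dec_induct) (auto simp: G_def step)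
  have "(\<lambda>n. \<Prod>i\<le>n. F (i + 0)) \<longlonglongrightarrow> G"
  proof (rule tendsto_fpsI)
    show "\<forall>\<^sub>F N in sequentially. (\<Prod>i\<le>N. F (i + 0)) $ n = G $ n" for n
      using eventually_ge_at_top[of n]
    proof eventually_elim
      case (elim N)
      then show ?case
        using P[of n "Suc N"] by (simp add: P_def lessThan_Suc_atMost)
    qed
  qed
  \<comment> \<open>The constant term matters because \<open>raw_has_prod\<close> demands a nonzero
    limit.\<close>
  moreover have "G $ 0 = 1" by (simp add: G_def P_def)
  then have "G \<noteq> 0" by auto
  ultimately have "F has_prod G" by (simp add: has_prod_def raw_has_prod_def)
  then have "prodinf F = G" by (rule has_prod_unique[symmetric])
  then show ?thesis using P[OF \<open>n \<le> N\<close>] by (simp add: P_def)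
qed

section \<open>The factors \<open>(1 - (p x)^j)^r\<close>\<close>

text \<open>The series \<open>(1 - (p x)^j)^r\<close>. Exponent \<open>- m j\<close> gives the
  \<open>j\<close>-th factor of the generating function, exponent \<open>m j\<close> its
  inverse.\<close>

definition binomial_factor :: "real \<Rightarrow> real \<Rightarrow> nat \<Rightarrow> real fps" where
  "binomial_factor p r j = fps_compose (fps_binomial r) (- ((fps_const p * fps_X) ^ j))"

lemma binomial_factor_nth:
  assumes "1 \<le> j"
  shows "binomial_factor p r j $ n =
    (if j dvd n then (r gchoose (n div j)) * (- (p ^ j)) ^ (n div j) else 0)"
proof -
  have *: "(- ((fps_const p * fps_X) ^ j)) ^ i = fps_const ((- (p ^ j)) ^ i) * fps_X ^ (j * i)" for i
  proof -
    have "- ((fps_const p * fps_X) ^ j) = fps_const (- (p ^ j)) * (fps_X ^ j :: real fps)"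
      unfolding power_mult_distrib fps_const_power by (simp flip: fps_const_neg)
    then show ?thesis
      by (simp only: power_mult_distrib fps_const_power power_mult)
  qed
  have eq: "n = j * i \<longleftrightarrow> j dvd n \<and> i = n div j" for i
    using assms by auto
  have "binomial_factor p r j $ n =
    (\<Sum>i=0..n. if i = n div j then (if j dvd n then (r gchoose i) * (- (p ^ j)) ^ i else 0) else 0)"
    unfolding binomial_factor_def fps_compose_nth
    by (intro sum.cong refl) (auto simp only: * fps_mult_left_const_nth fps_X_power_nth eq fps_binomial_nth split: if_splits)
  also have "\<dots> = (if j dvd n then (r gchoose (n div j)) * (- (p ^ j)) ^ (n div j) else 0)"
    by (simp add: div_le_dividend)
  finally show ?thesis .
qed

text \<open>Upper negation absorbs the sign of the substituted monomial. In this form the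
  coefficients are visibly nonnegative for positive \<open>p\<close> and \<open>r\<close>, and they
  match the negative binomial point masses up to normalisation.\<close>

lemma binomial_factor_minus_nth:
  assumes "1 \<le> j"
  shows "binomial_factor p (- r) j $ n =
    (if j dvd n then ((r + real (n div j) - 1) gchoose (n div j)) * p ^ n else 0)"
proof (cases "j dvd n")
  case True
  then obtain k where k: "n = j * k" by auto
  then have "n div j = k" using assms by simp
  moreover have "(- 1) ^ k * (- (p ^ j)) ^ k = p ^ n"
    by (simp add: k power_mult flip: power_mult_distrib)
  ultimately show ?thesis
    using assms True by (simp add: binomial_factor_nth gbinomial_minus mult_ac)
qed (use assms in \<open>simp add: binomial_factor_nth\<close>)

lemma binomial_factor_mult_minus:
  assumes "1 \<le> j"
  shows "binomial_factor p r j * binomial_factor p (- r) j = 1"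
proof -
  have "(- ((fps_const p * fps_X) ^ j)) $ 0 = (0::real)" 
    using assms by (cases j) auto
  from fps_compose_mult_distrib[OF this, of "fps_binomial r" "fps_binomial (- r)"]
  show ?thesis
    unfolding binomial_factor_def by (simp flip: fps_binomial_add_mult)
qed

text \<open>The binomial series converges absolutely at \<open>(p * x)^j\<close>, which is below 1;
  spreading its terms over the multiples of \<open>j\<close> only inserts zeros.\<close>

lemma binomial_factor_abs_summable:
  assumes "1 \<le> j" "0 \<le> p" "0 \<le> x" "p * x < 1"
  shows "summable (\<lambda>n. \<bar>binomial_factor p r j $ n\<bar> * x ^ n)"
proof -
  have j: "strict_mono (\<lambda>k. j * k)" using assms by (intro strict_monoI) auto
  have lt: "(p * x) ^ j < 1" using assms by (simp add: power_less_one_iff)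
  have "summable (\<lambda>k. norm ((r gchoose k) * ((p * x) ^ j) ^ k))"
  proof (rule abs_summable_in_conv_radius)
    have "ereal (norm ((p * x) ^ j)) < 1" using lt assms by (simp add: one_ereal_def)
    then show "ereal (norm ((p * x) ^ j)) < conv_radius (\<lambda>k. r gchoose k)"
      by (simp add: conv_radius_gchoose)
  qed
  also have "(\<lambda>k. norm ((r gchoose k) * ((p * x) ^ j) ^ k)) =
    (\<lambda>k. \<bar>binomial_factor p r j $ (j * k)\<bar> * x ^ (j * k))"
  proof
    fix k
    have "\<bar>((p * x) ^ j) ^ k\<bar> = \<bar>(- (p ^ j)) ^ k\<bar> * (x ^ j) ^ k"
      using assms(2,3) by (simp add: power_mult_distrib power_abs abs_mult)
    then show "norm ((r gchoose k) * ((p * x) ^ j) ^ k) = \<bar>binomial_factor p r j $ (j * k)\<bar> * x ^ (j * k)"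
      using assms(1) by (simp add: binomial_factor_nth power_mult abs_mult)
  qed
  also have "summable \<dots> \<longleftrightarrow> summable (\<lambda>n. \<bar>binomial_factor p r j $ n\<bar> * x ^ n)"
    by (rule summable_mono_reindex[OF j, of "\<lambda>n. \<bar>binomial_factor p r j $ n\<bar> * x ^ n"])
      (use assms(1) in \<open>auto simp: binomial_factor_nth\<close>)
  finally show ?thesis .
qed

lemma binomial_factor_sums:
  assumes "1 \<le> j" "0 \<le> p" "0 \<le> x" "p * x < 1"
  shows "(\<lambda>n. binomial_factor p r j $ n * x ^ n) sums ((1 - (p * x) ^ j) powr r)"
proof -
  have j: "strict_mono (\<lambda>k. j * k)" using assms by (intro strict_monoI) auto
  have lt: "(p * x) ^ j < 1" using assms by (simp add: power_less_one_iff)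
  have "(\<lambda>k. (r gchoose k) * (- ((p * x) ^ j)) ^ k) sums ((1 + - ((p * x) ^ j)) powr r)"
    by (rule gen_binomial_real) (use lt assms in simp)
  also have "(\<lambda>k. (r gchoose k) * (- ((p * x) ^ j)) ^ k) =
    (\<lambda>k. binomial_factor p r j $ (j * k) * x ^ (j * k))"
  proof
    fix k
    have "- ((p * x) ^ j) = - (p ^ j) * x ^ j" by (simp add: power_mult_distrib)
    then have "(- ((p * x) ^ j)) ^ k = (- (p ^ j)) ^ k * (x ^ j) ^ k"
      by (simp only: power_mult_distrib)
    then show "(r gchoose k) * (- ((p * x) ^ j)) ^ k = binomial_factor p r j $ (j * k) * x ^ (j * k)"
      using assms(1) by (simp add: binomial_factor_nth power_mult)
  qed
  also have "\<dots> sums ((1 + - ((p * x) ^ j)) powr r) \<longleftrightarrow>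
    (\<lambda>n. binomial_factor p r j $ n * x ^ n) sums ((1 + - ((p * x) ^ j)) powr r)"
    by (rule sums_mono_reindex[OF j, of "\<lambda>n. binomial_factor p r j $ n * x ^ n"])
      (use assms(1) in \<open>auto simp: binomial_factor_nth\<close>)
  finally show ?thesis by simp
qed

lemma gbinomial_shift_pos: "0 < r \<Longrightarrow> 0 < ((r + real k - 1) gchoose k)"
  by (simp add: gbinomial_pochhammer' pochhammer_pos)

text \<open>The rising factorial of \<open>r\<close> dominates that of 1, which is
  \<open>k!\<close>. This turns \<open>1 \<le> m 1\<close> into the lower bound \<open>p^k\<close>
  for the coefficients of the first factor.\<close>

lemma gbinomial_shift_ge_1:
  assumes "1 \<le> r"
  shows "1 \<le> ((r + real k - 1) gchoose k)"
proof -
  have "pochhammer 1 k \<le> pochhammer r k"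
    unfolding pochhammer_prod using assms by (intro prod_mono) auto
  then show ?thesis by (simp add: gbinomial_pochhammer' flip: pochhammer_fact)
qed

section \<open>Coefficients of the generating function\<close>

lemma fps_prod_nth_0: "(\<Prod>i\<in>A. F i :: 'a::comm_semiring_1 fps) $ 0 = (\<Prod>i\<in>A. F i $ 0)"
  by (induction A rule: infinite_finite_induct) auto

lemma fps_prod_nth_nonneg:
  fixes F :: "'i \<Rightarrow> 'a::linordered_semidom fps"
  assumes "\<And>i n. i \<in> A \<Longrightarrow> 0 \<le> F i $ n"
  shows "0 \<le> (\<Prod>i\<in>A. F i) $ n"
  using assms by (induction A arbitrary: n rule: infinite_finite_induct)
    (auto simp: fps_mult_nth intro!: sum_nonneg)

lemma multiset_gf_nth:
  assumes "n \<le> N"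
  shows "multiset_gf p m $ n = (\<Prod>j=1..N. binomial_factor p (- m j) j) $ n"
proof -
  have "multiset_gf p m = (\<Prod>i. binomial_factor p (- m (Suc i)) (Suc i))"
    by (simp add: multiset_gf_def binomial_factor_def)
  also have "\<dots> $ n = (\<Prod>i<N. binomial_factor p (- m (Suc i)) (Suc i)) $ n"
    by (rule prodinf_fps_nth[OF _ _ assms])
      (auto simp: binomial_factor_nth dest!: dvd_imp_le)
  also have "(\<Prod>i<N. binomial_factor p (- m (Suc i)) (Suc i)) = (\<Prod>j=1..N. binomial_factor p (- m j) j)"
    by (rule prod.reindex_bij_witness[of _ "\<lambda>j. j - 1" Suc]) auto
  finally show ?thesis .
qed

text \<open>Up to order \<open>n\<close> only the first \<open>n\<close> factors matter, and the
  inverse factors cancel the first \<open>l\<close> of them. The left-hand series does not depend on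
  \<open>n\<close>, which makes asymptotics in \<open>n\<close> possible.\<close>

lemma multiset_gf_mult_nth:
  assumes "l \<le> n" "s \<le> n"
  shows "(multiset_gf p m * (\<Prod>j=1..l. binomial_factor p (m j) j)) $ s =
    (\<Prod>j=Suc l..n. binomial_factor p (- m j) j) $ s"
proof -
  have "(multiset_gf p m * (\<Prod>j=1..l. binomial_factor p (m j) j)) $ s =
    ((\<Prod>j=1..n. binomial_factor p (- m j) j) * (\<Prod>j=1..l. binomial_factor p (m j) j)) $ s"
    using assms unfolding fps_mult_nth by (intro sum.cong) (auto simp: multiset_gf_nth[of _ n])
  also have "{1..n} = {1..l} \<union> {Suc l..n}" using assms by auto
  also have "(\<Prod>j\<in>{1..l} \<union> {Suc l..n}. binomial_factor p (- m j) j) =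
    (\<Prod>j=1..l. binomial_factor p (- m j) j) * (\<Prod>j=Suc l..n. binomial_factor p (- m j) j)"
    by (rule prod.union_disjoint) auto
  also have "\<dots> * (\<Prod>j=1..l. binomial_factor p (m j) j) =
    (\<Prod>j=1..l. binomial_factor p (m j) j * binomial_factor p (- m j) j) *
    (\<Prod>j=Suc l..n. binomial_factor p (- m j) j)"
    by (simp add: prod.distrib mult_ac)
  also have "(\<Prod>j=1..l. binomial_factor p (m j) j * binomial_factor p (- m j) j) = 1"
    by (simp add: binomial_factor_mult_minus)
  finally show ?thesis by simp
qed

text \<open>The factor \<open>j = 1\<close> has only positive coefficients; the product of the
  others has nonnegative coefficients and constant term 1.\<close>

lemma multiset_gf_pos:
  assumes "0 < p" "\<And>j. 1 \<le> j \<Longrightarrow> 1 \<le> m j"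
  shows "0 < multiset_gf p m $ n"
proof -
  let ?F = "\<lambda>j. binomial_factor p (- m j) j"
  have m: "0 < m j" if "1 \<le> j" for j using assms(2)[OF that] by simp
  have nn: "0 \<le> ?F j $ i" if "1 \<le> j" for i j
    using that assms m[OF that] by (auto simp: binomial_factor_minus_nth intro!: mult_nonneg_nonneg less_imp_le[OF gbinomial_shift_pos])
  let ?Q = "\<Prod>j=2..Suc n. ?F j"
  \<comment> \<open>The range runs to \<open>Suc n\<close> so that the factor \<open>j = 1\<close>
    is present even for \<open>n = 0\<close>.\<close>
  have "multiset_gf p m $ n = (\<Prod>j=1..Suc n. ?F j) $ n"
    by (rule multiset_gf_nth) simp
  also have "{1..Suc n} = insert 1 {2..Suc n}" by auto
  also have "(\<Prod>j\<in>insert 1 {2..Suc n}. ?F j) = ?F 1 * ?Q" by (subst prod.insert) auto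
  also have "(?F 1 * ?Q) $ n = (\<Sum>i=0..n. ?F 1 $ i * ?Q $ (n - i))" by (rule fps_mult_nth)
  also have "\<dots> > 0"
  proof (rule sum_pos2[of _ n])
    have "?F 1 $ n > 0" using assms m by (simp add: binomial_factor_minus_nth gbinomial_shift_pos)
    moreover have "?Q $ 0 = 1" by (simp add: fps_prod_nth_0 binomial_factor_nth)
    ultimately show "0 < ?F 1 $ n * ?Q $ (n - n)" by simp
    show "0 \<le> ?F 1 $ i * ?Q $ (n - i)" for i
      using nn by (intro mult_nonneg_nonneg fps_prod_nth_nonneg) auto
  qed auto
  finally show ?thesis .
qed


section \<open>Limits of coefficient quotients and Schur's theorem\<close>

text \<open>The quotient telescopes into \<open>k\<close> consecutive ones, each tending to
  \<open>r\<close>. The induction runs on \<open>c n / c (n + k)\<close>, free of truncated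
  subtraction, and the index is shifted at the end.\<close>

lemma tendsto_shifted_quotient:
  fixes c :: "nat \<Rightarrow> real"
  assumes nz: "\<forall>\<^sub>F n in sequentially. c n \<noteq> 0" and lim: "(\<lambda>n. c n / c (Suc n)) \<longlonglongrightarrow> r"
  shows "(\<lambda>n. c (n - k) / c n) \<longlonglongrightarrow> r ^ k"
proof -
  have "(\<lambda>n. c n / c (n + k)) \<longlonglongrightarrow> r ^ k"
  proof (induction k)
    case 0
    have "\<forall>\<^sub>F n in sequentially. c n / c (n + 0) = r ^ 0"
      using nz by eventually_elim simp
    then show ?case by (rule tendsto_eventually)
  next
    case (Suc k)
    have "(\<lambda>n. c n / c (n + k) * (c (n + k) / c (Suc (n + k)))) \<longlonglongrightarrow> r ^ k * r"
      by (intro tendsto_mult Suc LIMSEQ_ignore_initial_segment[OF lim])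
    moreover have "\<forall>\<^sub>F n in sequentially. c (n + k) \<noteq> 0"
      using nz by (rule sequentially_offset)
    then have "\<forall>\<^sub>F n in sequentially.
        c n / c (n + k) * (c (n + k) / c (Suc (n + k))) = c n / c (n + Suc k)"
      by eventually_elim simp
    ultimately have "(\<lambda>n. c n / c (n + Suc k)) \<longlonglongrightarrow> r ^ k * r"
      by (rule Lim_transform_eventually)
    then show ?case by (simp only: power_Suc mult.commute)
  qed
  then have "(\<lambda>n. c (n + k - k) / c (n + k)) \<longlonglongrightarrow> r ^ k" by simp
  then show ?thesis by (rule LIMSEQ_offset)
qed

text \<open>Schur's theorem. The quotient is the sum over \<open>k \<le> n\<close> of
  \<open>h $ k * (c $ (n - k) / c $ n)\<close>, whose terms tend to \<open>h $ k * r^k\<close>.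
  Since \<open>R\<close> exceeds \<open>r\<close>, the ratios of \<open>c\<close> are bounded by a
  multiple of \<open>R^k\<close>, and dominated convergence applies.\<close>

lemma fps_mult_quotient_tendsto:
  fixes c h :: "real fps"
  assumes pos: "\<forall>\<^sub>F n in sequentially. 0 < c $ n"
    and lim: "(\<lambda>n. c $ n / c $ Suc n) \<longlonglongrightarrow> r"
    and r: "0 \<le> r" "r < R" and sm: "summable (\<lambda>k. \<bar>h $ k\<bar> * R ^ k)"
  shows "(\<lambda>n. (c * h) $ n / c $ n) \<longlonglongrightarrow> (\<Sum>k. h $ k * r ^ k)"
proof -
  have "\<forall>\<^sub>F n in sequentially. 0 < c $ n \<and> c $ n / c $ Suc n < R"
    using pos order_tendstoD(2)[OF lim r(2)] by eventually_elim auto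
  then obtain N where N: "\<And>n. N \<le> n \<Longrightarrow> 0 < c $ n" "\<And>n. N \<le> n \<Longrightarrow> c $ n / c $ Suc n < R"
    by (auto simp: eventually_sequentially)
  have R: "0 < R" using r by simp
  \<comment> \<open>eventually increasing, which yields the dominating series for Tannery's theorem\<close>
  define b where "b n = \<bar>c $ n\<bar> * R ^ n" for n
  have b0: "0 \<le> b n" for n using R by (simp add: b_def)
  have bN: "0 < b n" if "N \<le> n" for n using R N(1)[OF that] by (simp add: b_def)
  have bSuc: "b n \<le> b (Suc n)" if "N \<le> n" for n
  proof -
    have "c $ n \<le> R * c $ Suc n"
      using N(1)[of "Suc n"] N(2)[OF that] that by (simp add: divide_simps)
    then have "c $ n * R ^ n \<le> R * c $ Suc n * R ^ n"
      using R by (intro mult_right_mono) auto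
    then show ?thesis
      using N(1)[of "Suc n"] N(1)[OF that] that by (simp add: b_def mult_ac)
  qed
  have mono: "b i \<le> b n" if "N \<le> i" "i \<le> n" for i n
    using that(2,1) by (induction rule: dec_induct) (auto intro: order_trans bSuc)
  \<comment> \<open>The summand 1 serves the indices from \<open>N\<close> on, where
    \<open>b\<close> increases; the quotient serves the finitely many earlier ones, where nothing is
    known about \<open>c\<close>.\<close>
  define C where "C = 1 + (\<Sum>i<N. b i) / b N"
  have C: "1 \<le> C" using bN[of N] by (simp add: C_def b0 sum_nonneg)
  have bC: "b i \<le> C * b n" if "N \<le> n" "i \<le> n" for i n
  proof (cases "N \<le> i")
    case True
    then show ?thesis
      using mono[OF True that(2)] mult_right_mono[OF C b0[of n]] by simp
  next
    case False
    then have "b i \<le> (\<Sum>i<N. b i)" by (intro member_le_sum) (auto simp: b0)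
    also have "\<dots> \<le> C * b N" using bN[of N] by (simp add: C_def field_simps)
    also have "\<dots> \<le> C * b n" using C mono[of N n] that by (intro mult_left_mono) auto
    finally show ?thesis .
  qed
  \<comment> \<open>Terms with \<open>k > n\<close> are set to 0, since truncated subtraction would
    make \<open>c $ (n - k)\<close> equal to \<open>c $ 0\<close> there.\<close>
  define a where "a k n = (if k \<le> n then h $ k * (c $ (n - k) / c $ n) else 0)" for k n
  have bound: "norm (a k n) \<le> C * (\<bar>h $ k\<bar> * R ^ k)" if "N \<le> n" for k n
  proof (cases "k \<le> n")
    case True
    have "\<bar>c $ (n - k)\<bar> * R ^ (n - k) \<le> C * c $ n * R ^ k * R ^ (n - k)"
      using bC[OF that, of "n - k"] N(1)[OF that] True
      by (simp add: b_def mult.assoc flip: power_add)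
    then have "\<bar>c $ (n - k)\<bar> \<le> C * c $ n * R ^ k"
      using R by (simp add: mult_le_cancel_right)
    then have "\<bar>c $ (n - k) / c $ n\<bar> \<le> C * R ^ k"
      using N(1)[OF that] by (simp add: field_simps)
    then have "\<bar>h $ k\<bar> * \<bar>c $ (n - k) / c $ n\<bar> \<le> \<bar>h $ k\<bar> * (C * R ^ k)"
      by (intro mult_left_mono) auto
    then show ?thesis using True by (simp add: a_def abs_mult mult_ac)
  qed (use C R in \<open>simp add: a_def\<close>)
  have ev: "\<forall>\<^sub>F n in sequentially. c $ n \<noteq> 0" using pos by eventually_elim auto
  have lim_a: "a k \<longlonglongrightarrow> h $ k * r ^ k" for k
  proof -
    have "(\<lambda>n. h $ k * (c $ (n - k) / c $ n)) \<longlonglongrightarrow> h $ k * r ^ k"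
      by (intro tendsto_mult tendsto_const tendsto_shifted_quotient[OF ev lim])
    moreover have "\<forall>\<^sub>F n in sequentially. h $ k * (c $ (n - k) / c $ n) = a k n"
      using eventually_ge_at_top[of k] by eventually_elim (auto simp: a_def)
    ultimately show ?thesis by (rule Lim_transform_eventually)
  qed
  have "(\<lambda>n. suminf (\<lambda>k. a k n)) \<longlonglongrightarrow> suminf (\<lambda>k. h $ k * r ^ k)"
  proof (rule tannerys_theorem[THEN conjunct2, THEN conjunct2])
    show "\<forall>\<^sub>F (k, n) in sequentially \<times>\<^sub>F sequentially. norm (a k n) \<le> C * (\<bar>h $ k\<bar> * R ^ k)"
      unfolding eventually_prod_filter
      using bound eventually_ge_at_top[of N]
      by (intro exI[of _ "\<lambda>_. True"] exI[of _ "\<lambda>n. N \<le> n"]) simp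
    show "summable (\<lambda>k. C * (\<bar>h $ k\<bar> * R ^ k))" using sm by (rule summable_mult)
  qed (rule lim_a sequentially_bot)+
  also have "(\<lambda>n. suminf (\<lambda>k. a k n)) = (\<lambda>n. (c * h) $ n / c $ n)"
  proof
    fix n
    have "suminf (\<lambda>k. a k n) = (\<Sum>k\<in>{0..n}. a k n)"
      by (rule suminf_finite) (auto simp: a_def)
    also have "\<dots> = (h * c) $ n / c $ n"
      by (simp add: a_def fps_mult_nth sum_divide_distrib)
    finally show "suminf (\<lambda>k. a k n) = (c * h) $ n / c $ n" by (simp add: mult.commute)
  qed
  finally show ?thesis .
qed

text \<open>Induction on \<open>l\<close>, applying Schur's theorem to one inverse factor at a time.
  Each partial product inherits the limiting quotient \<open>r\<close> from the generating function
  because its coefficients are asymptotically a positive multiple of those of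
  \<open>g\<close>.\<close>

lemma multiset_gf_mult_quotient_tendsto:
  assumes p: "0 < p" and m: "\<And>j. 1 \<le> j \<Longrightarrow> 1 \<le> m j"
    and lim: "(\<lambda>n. multiset_gf p m $ n / multiset_gf p m $ Suc n) \<longlonglongrightarrow> r"
    and r: "0 \<le> r" "p * r < 1"
  shows "(\<lambda>n. (multiset_gf p m * (\<Prod>j=1..l. binomial_factor p (m j) j)) $ n / multiset_gf p m $ n)
    \<longlonglongrightarrow> (\<Prod>j=1..l. (1 - (p * r) ^ j) powr m j)"
proof (induction l)
  case 0
  have "multiset_gf p m $ n \<noteq> 0" for n using multiset_gf_pos[of p m n, OF p m] by simp
  then show ?case by simp
next
  case (Suc l)
  define g where "g = multiset_gf p m"
  define c where "c = g * (\<Prod>j=1..l. binomial_factor p (m j) j)"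
  define L where "L = (\<Prod>j=1..l. (1 - (p * r) ^ j) powr m j)"
  define h where "h = binomial_factor p (m (Suc l)) (Suc l)"
  have g: "0 < g $ n" for n unfolding g_def using p m by (rule multiset_gf_pos)
  then have g0: "g $ n \<noteq> 0" for n by (metis less_irrefl)
  have lt: "(p * r) ^ j < 1" if "1 \<le> j" for j
    using that p r by (simp add: power_less_one_iff)
  \<comment> \<open>Here \<open>p * r < 1\<close> enters: a positive limit makes the coefficients of
    \<open>c\<close> eventually positive and lets \<open>L\<close> cancel in the quotient of
    neighbours.\<close>
  have L: "0 < L" unfolding L_def using lt by (intro prod_pos) force
  have c: "(\<lambda>n. c $ n / g $ n) \<longlonglongrightarrow> L"
    using Suc by (simp add: c_def L_def g_def)
  have pos: "\<forall>\<^sub>F n in sequentially. 0 < c $ n"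
    using order_tendstoD(1)[OF c L]
  proof eventually_elim
    case (elim n)
    then have "0 < c $ n / g $ n * g $ n" using g by (rule mult_pos_pos)
    then show ?case using g0 by simp
  qed
  have "(\<lambda>n. (c $ n / g $ n) * (g $ n / g $ Suc n) / (c $ Suc n / g $ Suc n)) \<longlonglongrightarrow> L * r / L"
    using L lim by (intro tendsto_intros c LIMSEQ_Suc[OF c]) (auto simp: g_def)
  then have limc: "(\<lambda>n. c $ n / c $ Suc n) \<longlonglongrightarrow> r"
    using L by (simp add: g0)
  have "r < 1 / p" using p r(2) by (simp add: pos_less_divide_eq mult.commute)
  \<comment> \<open>Any radius strictly between \<open>r\<close> and \<open>1 / p\<close> leaves
    room for domination while \<open>h\<close> still converges absolutely.\<close>
  then obtain R where R: "r < R" "R < 1 / p" using dense by blast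
  then have pR: "p * R < 1" using p by (simp add: pos_less_divide_eq mult.commute)
  have "(\<lambda>n. (c * h) $ n / c $ n) \<longlonglongrightarrow> (\<Sum>k. h $ k * r ^ k)"
    unfolding h_def using p r R pR
    by (intro fps_mult_quotient_tendsto[OF pos limc r(1) R(1)] binomial_factor_abs_summable) auto
  also have "(\<Sum>k. h $ k * r ^ k) = (1 - (p * r) ^ Suc l) powr m (Suc l)"
    unfolding h_def using p r by (intro sums_unique[symmetric] binomial_factor_sums) auto
  finally have "(\<lambda>n. (c $ n / g $ n) * ((c * h) $ n / c $ n)) \<longlonglongrightarrow>
      L * (1 - (p * r) ^ Suc l) powr m (Suc l)"
    by (intro tendsto_mult c)
  moreover have "\<forall>\<^sub>F n in sequentially. (c $ n / g $ n) * ((c * h) $ n / c $ n) = (c * h) $ n / g $ n"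
    using pos by eventually_elim auto
  ultimately have "(\<lambda>n. (c * h) $ n / g $ n) \<longlonglongrightarrow> L * (1 - (p * r) ^ Suc l) powr m (Suc l)"
    by (rule Lim_transform_eventually)
  moreover have "1 \<le> Suc l" by simp
  ultimately show ?case
    unfolding c_def h_def g_def L_def by (simp only: prod.nat_ivl_Suc' mult_ac)
qed

section \<open>Sums of independent variables as products of series\<close>

lemma fps_prod_const_mult_nth:
  "(\<Prod>i\<in>A. fps_const (c i) * F i) $ n = (\<Prod>i\<in>A. c i) * (\<Prod>i\<in>A. F i :: 'a::comm_ring_1 fps) $ n"
proof -
  have "(\<Prod>i\<in>A. fps_const (c i) * F i) = fps_const (\<Prod>i\<in>A. c i) * (\<Prod>i\<in>A. F i)"
    by (induction A rule: infinite_finite_induct) (auto simp: mult_ac simp flip: fps_const_mult)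
  then show ?thesis by simp
qed

text \<open>Induction on \<open>J\<close>: splitting by the value \<open>t\<close> of
  \<open>Y i\<close> moves \<open>i\<close> from the summed indices to the prescribed ones, and
  summing over \<open>t\<close> is a Cauchy product. Hence \<open>L\<close>, \<open>k\<close> and
  \<open>s\<close> must vary in the induction.\<close>

lemma (in prob_space) prob_coordinates_and_sum:
  fixes Y :: "'i \<Rightarrow> 'a \<Rightarrow> nat"
  assumes indep: "indep_vars (\<lambda>_. count_space UNIV) Y I"
    and "finite J" "finite L" "J \<subseteq> I" "L \<subseteq> I" "J \<inter> L = {}"
  shows "prob {\<omega> \<in> space M. (\<forall>j\<in>L. Y j \<omega> = k j) \<and> (\<Sum>j\<in>J. Y j \<omega>) = s} =
    (\<Prod>j\<in>L. prob {\<omega> \<in> space M. Y j \<omega> = k j}) *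
    (\<Prod>j\<in>J. Abs_fps (\<lambda>t. prob {\<omega> \<in> space M. Y j \<omega> = t})) $ s"
  using assms(2-)
proof (induction J arbitrary: L k s rule: finite_induct)
  case empty
  have "prob {\<omega> \<in> space M. \<forall>j\<in>L. Y j \<omega> = k j} = (\<Prod>j\<in>L. prob {\<omega> \<in> space M. Y j \<omega> = k j})"
  proof (cases "L = {}")
    case False
    then have "prob (\<Inter>j\<in>L. Y j -` {k j} \<inter> space M) = (\<Prod>j\<in>L. prob (Y j -` {k j} \<inter> space M))"
      using empty by (intro indep_varsD[OF indep]) auto
    moreover have "(\<Inter>j\<in>L. Y j -` {k j} \<inter> space M) = {\<omega> \<in> space M. \<forall>j\<in>L. Y j \<omega> = k j}"
      using False by auto
    moreover have "Y j -` {k j} \<inter> space M = {\<omega> \<in> space M. Y j \<omega> = k j}" for j by auto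
    ultimately show ?thesis by simp
  qed (simp add: prob_space)
  \<comment> \<open>The empty sum is 0 and the empty product is the series 1, so both sides vanish
    unless \<open>s = 0\<close>.\<close>
  then show ?case by (cases "s = 0") auto
next
  case (insert i J)
  have Y[measurable]: "Y j \<in> measurable M (count_space UNIV)" if "j \<in> I" for j
    using indep that by (auto simp: indep_vars_def)
  let ?F = "\<lambda>j. Abs_fps (\<lambda>t. prob {\<omega> \<in> space M. Y j \<omega> = t})"
  let ?E = "\<lambda>t. {\<omega> \<in> space M. (\<forall>j\<in>insert i L. Y j \<omega> = (k(i := t)) j) \<and> (\<Sum>j\<in>J. Y j \<omega>) = s - t}"
  have i: "i \<notin> L" using insert by auto
  have sets: "?E t \<in> events" for t
  proof -
    have "(\<lambda>\<omega>. \<Sum>j\<in>J. Y j \<omega>) \<in> measurable M (count_space UNIV)"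
      using insert.prems by (intro measurable_sum_nat Y) auto
    then have "{\<omega> \<in> space M. (\<Sum>j\<in>J. Y j \<omega>) = s - t} \<in> events" by measurable
    moreover have "{\<omega> \<in> space M. \<forall>j\<in>insert i L. Y j \<omega> = (k(i := t)) j} \<in> events"
    proof (rule sets.sets_Collect_finite_All')
      fix j assume "j \<in> insert i L"
      then have "j \<in> I" using insert.prems by auto
      from Y[OF this] show "{\<omega> \<in> space M. Y j \<omega> = (k(i := t)) j} \<in> events" by measurable
    qed (use insert in auto)
    ultimately have "{\<omega> \<in> space M. \<forall>j\<in>insert i L. Y j \<omega> = (k(i := t)) j} \<inter>
        {\<omega> \<in> space M. (\<Sum>j\<in>J. Y j \<omega>) = s - t} \<in> events"
      by (intro sets.Int)
    also have "{\<omega> \<in> space M. \<forall>j\<in>insert i L. Y j \<omega> = (k(i := t)) j} \<inter>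
        {\<omega> \<in> space M. (\<Sum>j\<in>J. Y j \<omega>) = s - t} = ?E t" by blast
    finally show ?thesis .
  qed
  have "{\<omega> \<in> space M. (\<forall>j\<in>L. Y j \<omega> = k j) \<and> (\<Sum>j\<in>insert i J. Y j \<omega>) = s} = (\<Union>t\<in>{0..s}. ?E t)"
    using insert(1,2) i by (auto simp: fun_upd_def)
  also have "prob \<dots> = (\<Sum>t=0..s. prob (?E t))"
  proof (rule finite_measure_finite_Union)
    show "?E ` {0..s} \<subseteq> events" using sets by blast
  qed (auto simp: disjoint_family_on_def)
  also have "\<dots> = (\<Sum>t=0..s. (\<Prod>j\<in>L. prob {\<omega> \<in> space M. Y j \<omega> = k j}) * (?F i $ t * (\<Prod>j\<in>J. ?F j) $ (s - t)))"
  proof (intro sum.cong refl)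
    fix t
    have "prob (?E t) = (\<Prod>j\<in>insert i L. prob {\<omega> \<in> space M. Y j \<omega> = (k(i := t)) j}) *
      (\<Prod>j\<in>J. ?F j) $ (s - t)"
      using insert.prems insert.hyps by (intro insert.IH) auto
    also have "(\<Prod>j\<in>insert i L. prob {\<omega> \<in> space M. Y j \<omega> = (k(i := t)) j}) =
      ?F i $ t * (\<Prod>j\<in>L. prob {\<omega> \<in> space M. Y j \<omega> = (k(i := t)) j})"
      using i insert.prems by simp
    also have "(\<Prod>j\<in>L. prob {\<omega> \<in> space M. Y j \<omega> = (k(i := t)) j}) = (\<Prod>j\<in>L. prob {\<omega> \<in> space M. Y j \<omega> = k j})"
      using i by (intro prod.cong) auto
    finally show "prob (?E t) =
      (\<Prod>j\<in>L. prob {\<omega> \<in> space M. Y j \<omega> = k j}) * (?F i $ t * (\<Prod>j\<in>J. ?F j) $ (s - t))"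
      by (simp only: mult_ac)
  qed
  also have "\<dots> = (\<Prod>j\<in>L. prob {\<omega> \<in> space M. Y j \<omega> = k j}) * (?F i * (\<Prod>j\<in>J. ?F j)) $ s"
    unfolding fps_mult_nth by (simp only: sum_distrib_left)
  also have "?F i * (\<Prod>j\<in>J. ?F j) = (\<Prod>j\<in>insert i J. ?F j)"
    using insert(1,2) by simp
  finally show ?case .
qed

section \<open>Point masses, test functions and weak convergence\<close>

text \<open>With respect to counting measure on \<open>S\<close> the point masses are densities of
  total mass 1, and so is their limit. Scheffe's lemma upgrades pointwise to L1 convergence, which
  survives multiplication by a bounded function.\<close>

lemma integral_tendsto_of_point_masses:
  fixes f :: "'b \<Rightarrow> real" and Q :: "'b pmf"
  assumes S: "countable S" "set_pmf Q \<subseteq> S"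
    and U: "\<And>n. prob_space (U n)" "\<And>n. W \<in> measurable (U n) (count_space S)"
    and lim: "\<And>k. k \<in> S \<Longrightarrow> (\<lambda>n. measure (U n) {\<omega> \<in> space (U n). W \<omega> = k}) \<longlonglongrightarrow> pmf Q k"
    and f: "bounded (f ` S)"
  shows "(\<lambda>n. \<integral>\<omega>. f (W \<omega>) \<partial>U n) \<longlonglongrightarrow> (\<integral>k. f k \<partial>Q)"
proof -
  define D where "D n = distr (U n) (count_space S) W" for n
  define \<kappa> where "\<kappa> n k = measure (D n) {k}" for n k
  have D: "prob_space (D n)" for n
    unfolding D_def using U by (intro prob_space.prob_space_distr)
  have eq: "D n = density (count_space S) (\<kappa> n)" for n
  proof (rule measure_eqI_countable[of _ S])
    fix k assume k: "k \<in> S"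
    interpret prob_space "D n" by (rule D)
    have "emeasure (density (count_space S) (\<kappa> n)) {k} = (\<integral>\<^sup>+x. ennreal (\<kappa> n k) * indicator {k} x \<partial>count_space S)"
      using k by (subst emeasure_density) (auto intro!: nn_integral_cong split: split_indicator)
    also have "\<dots> = ennreal (\<kappa> n k)"
      using k by (subst nn_integral_cmult_indicator) auto
    finally show "emeasure (D n) {k} = emeasure (density (count_space S) (\<kappa> n)) {k}"
      by (simp add: \<kappa>_def emeasure_eq_measure)
  qed (auto simp: D_def S)
  have nn_\<kappa>: "(\<integral>\<^sup>+k. ennreal (\<kappa> n k) \<partial>count_space S) = 1" for n
  proof -
    interpret prob_space "D n" by (rule D)
    have "(\<integral>\<^sup>+k. ennreal (\<kappa> n k) \<partial>count_space S) = emeasure (density (count_space S) (\<kappa> n)) S"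
      by (subst emeasure_density) (auto intro!: nn_integral_cong)
    also have "\<dots> = emeasure (D n) (space (D n))" by (simp flip: eq) (simp add: D_def)
    finally show ?thesis by (simp add: emeasure_space_1)
  qed
  have nn_Q: "(\<integral>\<^sup>+k. ennreal (pmf Q k) \<partial>count_space S) = 1"
    using S by (simp add: nn_integral_pmf measure_pmf.emeasure_eq_1_AE AE_measure_pmf_iff subset_iff)
  have int_\<kappa>: "integrable (count_space S) (\<kappa> n)" for n
    using nn_\<kappa>[of n] by (intro integrableI_nonneg) (auto simp: \<kappa>_def)
  have int_Q: "integrable (count_space S) (pmf Q)"
    using nn_Q by (intro integrableI_nonneg) auto
  have scheffe: "(\<lambda>n. \<integral>\<^sup>+k. norm (\<kappa> n k - pmf Q k) \<partial>count_space S) \<longlonglongrightarrow> 0"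
  proof (rule Scheffe_lemma2)
    have "(\<lambda>n. \<kappa> n k) \<longlonglongrightarrow> pmf Q k" if "k \<in> S" for k
    proof -
      have "\<kappa> n k = measure (U n) {\<omega> \<in> space (U n). W \<omega> = k}" for n
        using that U(2)[of n] by (auto simp: \<kappa>_def D_def measure_distr vimage_def Int_def conj_commute)
      then show ?thesis using lim[OF that] by simp
    qed
    then show "AE k in count_space S. (\<lambda>n. \<kappa> n k) \<longlonglongrightarrow> pmf Q k" by (simp add: AE_count_space)
  qed (use int_Q nn_\<kappa> nn_Q in \<open>auto simp: \<kappa>_def\<close>)
  obtain B where B: "0 < B" "\<And>k. k \<in> S \<Longrightarrow> \<bar>f k\<bar> \<le> B"
    using f by (auto simp: bounded_pos)
  have int: "integrable (count_space S) (\<lambda>k. g k * f k)" if "integrable (count_space S) g" for g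
  proof (rule Bochner_Integration.integrable_bound)
    show "integrable (count_space S) (\<lambda>k. B * g k)" using that by simp
    show "AE k in count_space S. norm (g k * f k) \<le> norm (B * g k)"
      using B by (auto simp: AE_count_space abs_mult mult.commute[of "\<bar>g _\<bar>"] intro!: mult_right_mono)
  qed auto
  have "(\<lambda>n. \<integral>k. \<kappa> n k * f k \<partial>count_space S) \<longlonglongrightarrow> (\<integral>k. pmf Q k * f k \<partial>count_space S)"
  proof (rule tendsto_L1_int)
    have "(\<integral>\<^sup>+k. norm (\<kappa> n k * f k - pmf Q k * f k) \<partial>count_space S) \<le>
      ennreal B * (\<integral>\<^sup>+k. norm (\<kappa> n k - pmf Q k) \<partial>count_space S)" for n
    proof -
      have "(\<integral>\<^sup>+k. norm (\<kappa> n k * f k - pmf Q k * f k) \<partial>count_space S) \<le>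
        (\<integral>\<^sup>+k. ennreal B * norm (\<kappa> n k - pmf Q k) \<partial>count_space S)"
      proof (rule nn_integral_mono)
        fix k assume "k \<in> space (count_space S)"
        then have "\<bar>f k\<bar> * \<bar>\<kappa> n k - pmf Q k\<bar> \<le> B * \<bar>\<kappa> n k - pmf Q k\<bar>"
          using B by (intro mult_right_mono) auto
        then show "ennreal (norm (\<kappa> n k * f k - pmf Q k * f k)) \<le> ennreal B * norm (\<kappa> n k - pmf Q k)"
          using B unfolding left_diff_distrib[symmetric]
          by (simp add: abs_mult mult.commute flip: ennreal_mult)
      qed
      then show ?thesis by (simp add: nn_integral_cmult)
    qed
    note le = this
    have "(\<lambda>n. ennreal B * (\<integral>\<^sup>+k. norm (\<kappa> n k - pmf Q k) \<partial>count_space S)) \<longlonglongrightarrow> ennreal B * 0"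
      by (intro ennreal_tendsto_cmult scheffe) auto
    then have lim0: "(\<lambda>n. ennreal B * (\<integral>\<^sup>+k. norm (\<kappa> n k - pmf Q k) \<partial>count_space S)) \<longlonglongrightarrow> 0"
      by simp
    show "(\<lambda>n. \<integral>\<^sup>+k. norm (\<kappa> n k * f k - pmf Q k * f k) \<partial>count_space S) \<longlonglongrightarrow> 0"
      by (rule tendsto_sandwich[OF _ _ tendsto_const lim0])
        (use le in \<open>auto intro!: always_eventually\<close>)
  qed (use int int_\<kappa> int_Q in auto)
  moreover have "(\<integral>\<omega>. f (W \<omega>) \<partial>U n) = (\<integral>k. \<kappa> n k * f k \<partial>count_space S)" for n
  proof -
    have "(\<integral>\<omega>. f (W \<omega>) \<partial>U n) = integral\<^sup>L (D n) f"
      unfolding D_def using U(2) by (subst integral_distr) auto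
    also have "\<dots> = (\<integral>k. \<kappa> n k * f k \<partial>count_space S)"
      unfolding eq by (subst integral_density) (auto simp: \<kappa>_def)
    finally show ?thesis .
  qed
  moreover have "(\<integral>k. f k \<partial>Q) = (\<integral>k. pmf Q k * f k \<partial>count_space S)"
  proof -
    have "(\<integral>k. f k \<partial>Q) = (\<integral>k. pmf Q k * f k \<partial>count_space UNIV)"
      unfolding measure_pmf_eq_density by (subst integral_density) auto
    also have "\<dots> = (\<integral>k. indicator S k *\<^sub>R (pmf Q k * f k) \<partial>count_space UNIV)"
      using S by (intro Bochner_Integration.integral_cong) (auto simp: set_pmf_eq split: split_indicator)
    also have "\<dots> = (\<integral>k. pmf Q k * f k \<partial>restrict_space (count_space UNIV) S)"
      by (subst integral_restrict_space) auto
    finally show ?thesis by (simp add: restrict_count_space)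
  qed
  ultimately show ?thesis by simp
qed

text \<open>Composing \<open>f\<close> with restriction to \<open>I\<close> gives a function
  continuous on the whole function space, hence Borel there. The index type being countable, the
  identity from the product sigma-algebra to the Borel one is measurable coordinatewise.\<close>

lemma borel_measurable_PiM_continuous:
  fixes f :: "('i::countable \<Rightarrow> real) \<Rightarrow> real"
  assumes "continuous_on (\<Pi>\<^sub>E i\<in>I. UNIV) f"
  shows "f \<in> borel_measurable (\<Pi>\<^sub>M i\<in>I. borel)"
proof -
  let ?r = "\<lambda>x. \<lambda>i\<in>I. x i :: real"
  have "continuous_on UNIV ?r"
  proof (rule continuous_on_coordinatewise_then_product)
    fix i show "continuous_on UNIV (\<lambda>x. ?r x i)"
      by (cases "i \<in> I") (auto intro: continuous_on_product_coordinates)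
  qed
  then have "continuous_on UNIV (\<lambda>x. f (?r x))"
    by (rule continuous_on_compose2[OF assms]) auto
  then have "(\<lambda>x. f (?r x)) \<in> borel_measurable borel"
    by (rule borel_measurable_continuous_onI)
  moreover have "(\<lambda>x. x) \<in> measurable (\<Pi>\<^sub>M i\<in>I. borel) (borel :: ('i \<Rightarrow> real) measure)"
  proof (rule measurable_coordinatewise_then_product)
    fix i
    show "(\<lambda>x. x i) \<in> borel_measurable (\<Pi>\<^sub>M i\<in>I. borel :: real measure)"
    proof (cases "i \<in> I")
      \<comment> \<open>Points of the product space take the constant value \<open>undefined\<close>
        outside \<open>I\<close>.\<close>
      case False
      then have "x i = undefined" if "x \<in> space (\<Pi>\<^sub>M i\<in>I. borel :: real measure)" for x
        using that by (auto simp: space_PiM PiE_def extensional_def)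
      then show ?thesis by (subst measurable_cong[where g = "\<lambda>_. undefined"]) auto
    qed simp
  qed
  ultimately have "(\<lambda>x. f (?r x)) \<in> borel_measurable (\<Pi>\<^sub>M i\<in>I. borel)"
    by (rule measurable_compose[rotated])
  moreover have "?r x = x" if "x \<in> space (\<Pi>\<^sub>M i\<in>I. borel :: real measure)" for x
    using that by (simp add: space_PiM PiE_def extensional_restrict)
  ultimately show ?thesis by (subst (asm) measurable_cong) auto
qed

section \<open>Negative binomial laws\<close>

lemma neg_binomial_prob_nonneg: "0 < r \<Longrightarrow> 0 \<le> q \<Longrightarrow> 0 \<le> neg_binomial_prob r q k"
  by (simp add: neg_binomial_prob_def less_imp_le gbinomial_shift_pos)

text \<open>This is the binomial series with exponent \<open>- r\<close> at \<open>- q\<close>. The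
  case \<open>q = 0\<close> is included because the limiting quotient may be 0.\<close>

lemma neg_binomial_prob_sums:
  assumes "0 \<le> q" "q < 1"
  shows "neg_binomial_prob r q sums 1"
proof -
  have "(\<lambda>k. (- r gchoose k) * (- q) ^ k) sums ((1 + - q) powr - r)"
    by (rule gen_binomial_real) (use assms in simp)
  moreover have "(- r gchoose k) * (- q) ^ k = ((r + real k - 1) gchoose k) * q ^ k" for k
    unfolding gbinomial_minus by (simp add: mult_ac flip: power_mult_distrib)
  ultimately have "(\<lambda>k. (1 - q) powr r * (((r + real k - 1) gchoose k) * q ^ k)) sums
      ((1 - q) powr r * (1 - q) powr - r)"
    by (intro sums_mult) simp
  then show ?thesis
    using assms by (simp add: neg_binomial_prob_def[abs_def] mult.assoc flip: powr_add)
qed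

lemma pmf_neg_binomial:
  assumes "0 < r" "0 \<le> q" "q < 1"
  shows "pmf (embed_pmf (neg_binomial_prob r q)) k = neg_binomial_prob r q k"
proof (rule pmf_embed_pmf)
  have "(\<integral>\<^sup>+k. ennreal (neg_binomial_prob r q k) \<partial>count_space UNIV) = ennreal 1"
    using assms unfolding nn_integral_count_space_nat
    by (intro suminf_ennreal_eq neg_binomial_prob_nonneg neg_binomial_prob_sums) auto
  then show "(\<integral>\<^sup>+k. ennreal (neg_binomial_prob r q k) \<partial>count_space UNIV) = 1" by simp
qed (use assms in \<open>auto intro: neg_binomial_prob_nonneg\<close>)

section \<open>The conditioned process and its point masses\<close>

locale multiset_structure = prob_space M for M :: "'a measure" +
  fixes Z :: "nat \<Rightarrow> 'a \<Rightarrow> nat" and m :: "nat \<Rightarrow> real" and p :: real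
  assumes p: "0 < p" "p < 1"
    and m: "\<And>j. 1 \<le> j \<Longrightarrow> 1 \<le> m j"
    and indep: "indep_vars (\<lambda>_. count_space UNIV) Z {1..}"
    and prob_Z: "\<And>j k. 1 \<le> j \<Longrightarrow> prob {\<omega> \<in> space M. Z j \<omega> = k} = neg_binomial_prob (m j) (p ^ j) k"
begin

definition total :: "nat \<Rightarrow> 'a set" where
  "total n = {\<omega> \<in> space M. (\<Sum>j = 1..n. j * Z j \<omega>) = n}"

definition conditioned :: "nat \<Rightarrow> 'a measure" where
  "conditioned n = uniform_measure M (total n)"

definition g :: "real fps" where "g = multiset_gf p m"

text \<open>The generating function without its first \<open>l\<close> factors, written with
  inverses of factors rather than as another infinite product.\<close>

definition e :: "nat \<Rightarrow> real fps" where "e l = g * (\<Prod>j=1..l. binomial_factor p (m j) j)"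

text \<open>The probability of \<open>Z j = 0\<close>, that is, the normalising constant of the law
  of \<open>Z j\<close>.\<close>

definition C :: "nat \<Rightarrow> real" where "C j = (1 - p ^ j) powr m j"

lemma m_pos: "1 \<le> j \<Longrightarrow> 0 < m j"
  using m[of j] by simp

lemma g_pos: "0 < g $ n"
  unfolding g_def using p(1) m by (rule multiset_gf_pos)

lemma C_pos: "1 \<le> j \<Longrightarrow> 0 < C j"
  using p by (simp add: C_def power_less_one_iff order_less_imp_not_eq2)

lemma measurable_Z: "1 \<le> j \<Longrightarrow> Z j \<in> measurable M (count_space UNIV)"
  using indep by (auto simp: indep_vars_def)

lemma prob_mult_Z:
  assumes "1 \<le> j"
  shows "prob {\<omega> \<in> space M. j * Z j \<omega> = t} = C j * binomial_factor p (- m j) j $ t"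
proof (cases "j dvd t")
  case True
  then obtain k where k: "t = j * k" by auto
  have "{\<omega> \<in> space M. j * Z j \<omega> = t} = {\<omega> \<in> space M. Z j \<omega> = k}"
    using assms by (auto simp: k)
  then show ?thesis
    using assms by (simp add: prob_Z neg_binomial_prob_def binomial_factor_minus_nth k C_def power_mult)
next
  case False
  then have "{\<omega> \<in> space M. j * Z j \<omega> = t} = {}" by auto
  then show ?thesis using assms False by (simp only: binomial_factor_minus_nth) simp
qed

lemma prob_coordinates_and_weighted_sum:
  assumes "finite J" "finite L" "J \<subseteq> {1..}" "L \<subseteq> {1..}" "J \<inter> L = {}"
  shows "prob {\<omega> \<in> space M. (\<forall>j\<in>L. Z j \<omega> = k j) \<and> (\<Sum>j\<in>J. j * Z j \<omega>) = s} =
    (\<Prod>j\<in>L. C j * (((m j + real (k j) - 1) gchoose (k j)) * p ^ (j * k j))) *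
    ((\<Prod>j\<in>J. C j) * (\<Prod>j\<in>J. binomial_factor p (- m j) j) $ s)"
proof -
  let ?Y = "\<lambda>j \<omega>. j * Z j \<omega>"
  have "indep_vars (\<lambda>_. count_space UNIV) ?Y {1..}"
    using indep_vars_compose2[OF indep, of "\<lambda>j. (*) j" "\<lambda>_. count_space UNIV"] by simp
  note * = prob_coordinates_and_sum[OF this assms, of "\<lambda>j. j * k j" s]
  have "{\<omega> \<in> space M. (\<forall>j\<in>L. Z j \<omega> = k j) \<and> (\<Sum>j\<in>J. j * Z j \<omega>) = s} =
    {\<omega> \<in> space M. (\<forall>j\<in>L. j * Z j \<omega> = j * k j) \<and> (\<Sum>j\<in>J. j * Z j \<omega>) = s}"
    using assms(4) by force
  also have "prob \<dots> = (\<Prod>j\<in>L. prob {\<omega> \<in> space M. j * Z j \<omega> = j * k j}) *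
    (\<Prod>j\<in>J. Abs_fps (\<lambda>t. prob {\<omega> \<in> space M. j * Z j \<omega> = t})) $ s"
    by (rule *)
  also have "(\<Prod>j\<in>L. prob {\<omega> \<in> space M. j * Z j \<omega> = j * k j}) =
    (\<Prod>j\<in>L. C j * (((m j + real (k j) - 1) gchoose (k j)) * p ^ (j * k j)))"
  proof (intro prod.cong refl)
    fix j assume "j \<in> L"
    then have "1 \<le> j" using assms(4) by auto
    then show "prob {\<omega> \<in> space M. j * Z j \<omega> = j * k j} = C j * (((m j + real (k j) - 1) gchoose (k j)) * p ^ (j * k j))"
      by (subst prob_mult_Z) (simp_all add: binomial_factor_minus_nth)
  qed
  also have "(\<Prod>j\<in>J. Abs_fps (\<lambda>t. prob {\<omega> \<in> space M. j * Z j \<omega> = t})) =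
    (\<Prod>j\<in>J. fps_const (C j) * binomial_factor p (- m j) j)"
  proof (intro prod.cong refl fps_ext)
    fix j t assume "j \<in> J"
    then have "1 \<le> j" using assms(3) by auto
    then show "Abs_fps (\<lambda>t. prob {\<omega> \<in> space M. j * Z j \<omega> = t}) $ t = (fps_const (C j) * binomial_factor p (- m j) j) $ t"
      by (simp add: prob_mult_Z)
  qed
  finally show ?thesis by (simp only: fps_prod_const_mult_nth)
qed

lemma prob_total: "prob (total n) = (\<Prod>j=1..n. C j) * g $ n"
  using prob_coordinates_and_weighted_sum[of "{1..n}" "{}" _ n]
  by (simp add: total_def g_def multiset_gf_nth[of n n])

lemma prob_total_pos: "0 < prob (total n)"
  unfolding prob_total using g_pos by (intro mult_pos_pos prod_pos C_pos) auto

text \<open>A nonmeasurable set has measure 0 by convention, so positive probability already implies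
  measurability.\<close>

lemma total_events: "total n \<in> events"
  using prob_total_pos[of n] measure_notin_sets by (metis less_irrefl)

lemma prob_space_conditioned: "prob_space (conditioned n)"
  unfolding conditioned_def using prob_total_pos[of n]
  by (intro prob_space_uniform_measure) (auto simp: emeasure_eq_measure)

lemma sets_conditioned [measurable_cong]: "sets (conditioned n) = sets M"
  and space_conditioned [simp]: "space (conditioned n) = space M"
  by (simp_all add: conditioned_def)

lemma measurable_Z_conditioned: "1 \<le> j \<Longrightarrow> Z j \<in> measurable (conditioned n) (count_space UNIV)"
  using measurable_Z by (simp cong: measurable_cong_sets add: sets_conditioned)

text \<open>Once the first \<open>l\<close> values are fixed, the remaining weighted sum must make
  up the difference to \<open>n\<close>; independence separates the two parts, and all constants
  \<open>C j\<close> cancel against those in \<open>prob (total n)\<close>. The \<open>if\<close>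
  guards against truncated subtraction.\<close>

lemma measure_conditioned:
  assumes "l \<le> n"
  shows "measure (conditioned n) {\<omega> \<in> space M. \<forall>j\<in>{1..l}. Z j \<omega> = k j} =
    (\<Prod>j=1..l. ((m j + real (k j) - 1) gchoose (k j)) * p ^ (j * k j)) *
    ((if (\<Sum>j=1..l. j * k j) \<le> n then e l $ (n - (\<Sum>j=1..l. j * k j)) else 0) / g $ n)"
proof -
  let ?B = "{\<omega> \<in> space M. \<forall>j\<in>{1..l}. Z j \<omega> = k j}"
  let ?s = "\<Sum>j=1..l. j * k j"
  let ?a = "\<Prod>j=1..l. ((m j + real (k j) - 1) gchoose (k j)) * p ^ (j * k j)"
  have un: "{1..n} = {1..l} \<union> {Suc l..n}" using assms by auto
  have sum: "(\<Sum>j=1..n. j * Z j \<omega>) = (\<Sum>j=1..l. j * Z j \<omega>) + (\<Sum>j=Suc l..n. j * Z j \<omega>)" for \<omega>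
    unfolding un by (rule sum.union_disjoint) auto
  have C: "(\<Prod>j=1..n. C j) = (\<Prod>j=1..l. C j) * (\<Prod>j=Suc l..n. C j)"
    unfolding un by (rule prod.union_disjoint) auto
  have "?B \<in> events"
  proof (rule sets.sets_Collect_finite_All)
    fix j assume "j \<in> {1..l}"
    then have "Z j \<in> measurable M (count_space UNIV)" by (intro measurable_Z) auto
    then show "{\<omega> \<in> space M. Z j \<omega> = k j} \<in> events" by measurable
  qed simp
  then have cond: "measure (conditioned n) ?B = prob (total n \<inter> ?B) / prob (total n)"
    unfolding conditioned_def using prob_total_pos[of n]
    by (intro measure_uniform_measure) (auto simp: emeasure_eq_measure)
  have joint: "prob (total n \<inter> ?B) = (if ?s \<le> n then
      ?a * (\<Prod>j=1..n. C j) * e l $ (n - ?s) else 0)"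
  proof (cases "?s \<le> n")
    case True
    have event: "total n \<inter> ?B =
        {\<omega> \<in> space M. (\<forall>j\<in>{1..l}. Z j \<omega> = k j) \<and> (\<Sum>j=Suc l..n. j * Z j \<omega>) = n - ?s}"
      using True unfolding total_def sum by auto
    have "e l $ (n - ?s) = (\<Prod>j=Suc l..n. binomial_factor p (- m j) j) $ (n - ?s)"
      unfolding e_def g_def using assms by (intro multiset_gf_mult_nth) auto
    moreover have "prob (total n \<inter> ?B) =
      (\<Prod>j=1..l. C j * (((m j + real (k j) - 1) gchoose (k j)) * p ^ (j * k j))) *
      ((\<Prod>j=Suc l..n. C j) * (\<Prod>j=Suc l..n. binomial_factor p (- m j) j) $ (n - ?s))"
      unfolding event by (rule prob_coordinates_and_weighted_sum) auto
    ultimately show ?thesis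
      using True by (simp only: C prod.distrib if_True mult_ac)
  next
    case False
    then have "total n \<inter> ?B = {}" unfolding total_def sum by auto
    then show ?thesis using False by simp
  qed
  have "0 < (\<Prod>j=1..n. C j)" by (intro prod_pos C_pos) auto
  then have "(\<Prod>j=1..n. C j) \<noteq> 0" by (rule less_imp_neq[symmetric])
  then show ?thesis unfolding cond joint prob_total by (simp del: prod_zero_iff)
qed

lemma marginal_counting_law:
  assumes "l \<le> n"
  shows "marginal_law l (counting_law M Z n) =
    distr (conditioned n) (\<Pi>\<^sub>M j\<in>{1..l}. borel) (\<lambda>\<omega>. \<lambda>j\<in>{1..l}. real (Z j \<omega>))"
proof -
  have "(\<lambda>\<omega>. \<lambda>j\<in>{1..n}. Z j \<omega>) \<in> measurable (conditioned n) (\<Pi>\<^sub>M j\<in>{1..n}. count_space UNIV)"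
    by (intro measurable_restrict measurable_Z_conditioned) auto
  moreover have "(\<lambda>k. \<lambda>j\<in>{1..l}. real (k j)) \<in> measurable (\<Pi>\<^sub>M j\<in>{1..n}. count_space UNIV) (\<Pi>\<^sub>M j\<in>{1..l}. borel)"
  proof (intro measurable_restrict)
    fix j assume "j \<in> {1..l}"
    then have "(\<lambda>k. k j) \<in> measurable (\<Pi>\<^sub>M j\<in>{1..n}. count_space (UNIV :: nat set)) (count_space UNIV)"
      using assms by (intro measurable_component_singleton) auto
    then show "(\<lambda>k. real (k j)) \<in> borel_measurable (\<Pi>\<^sub>M j\<in>{1..n}. count_space (UNIV :: nat set))"
      by (rule measurable_compose) simp
  qed
  ultimately have "marginal_law l (counting_law M Z n) = distr (conditioned n) (\<Pi>\<^sub>M j\<in>{1..l}. borel)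
      ((\<lambda>k. \<lambda>j\<in>{1..l}. real (k j)) \<circ> (\<lambda>\<omega>. \<lambda>j\<in>{1..n}. Z j \<omega>))"
    unfolding marginal_law_def counting_law_def by (subst distr_distr) (simp_all add: conditioned_def total_def)
  also have "(\<lambda>k. \<lambda>j\<in>{1..l}. real (k j)) \<circ> (\<lambda>\<omega>. \<lambda>j\<in>{1..n}. Z j \<omega>) = (\<lambda>\<omega>. \<lambda>j\<in>{1..l}. real (Z j \<omega>))"
    using assms by (auto simp: fun_eq_iff)
  finally show ?thesis .
qed

lemma integral_marginal_counting_law:
  fixes f :: "(nat \<Rightarrow> real) \<Rightarrow> real"
  assumes "l \<le> n" "f \<in> borel_measurable (\<Pi>\<^sub>M j\<in>{1..l}. borel)"
  shows "integral\<^sup>L (marginal_law l (counting_law M Z n)) f =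
    (\<integral>\<omega>. f (\<lambda>j\<in>{1..l}. real (Z j \<omega>)) \<partial>conditioned n)"
  unfolding marginal_counting_law[OF assms(1)]
proof (rule integral_distr[OF _ assms(2)])
  show "(\<lambda>\<omega>. \<lambda>j\<in>{1..l}. real (Z j \<omega>)) \<in> measurable (conditioned n) (\<Pi>\<^sub>M j\<in>{1..l}. borel)"
    by (intro measurable_restrict measurable_compose[OF measurable_Z_conditioned]) auto
qed

section \<open>From coefficient quotients to a convergent structure\<close>

text \<open>With \<open>s\<close> the weighted sum of the prescribed values,
  \<open>e l $ (n - s) / g $ n\<close> splits at \<open>g $ (n - s)\<close> into a Schur quotient
  and a shifted quotient tending to \<open>r^s\<close>. The latter turns each \<open>p^j\<close>
  into \<open>(p * r)^j\<close>.\<close>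

lemma point_mass_tendsto:
  assumes lim: "(\<lambda>n. g $ n / g $ Suc n) \<longlonglongrightarrow> r" and r: "0 \<le> r" "p * r < 1"
  shows "(\<lambda>n. measure (conditioned n) {\<omega> \<in> space M. \<forall>j\<in>{1..l}. Z j \<omega> = k j}) \<longlonglongrightarrow>
    (\<Prod>j=1..l. neg_binomial_prob (m j) ((p * r) ^ j) (k j))"
proof -
  let ?s = "\<Sum>j=1..l. j * k j"
  let ?a = "\<Prod>j=1..l. ((m j + real (k j) - 1) gchoose (k j)) * p ^ (j * k j)"
  let ?L = "\<Prod>j=1..l. (1 - (p * r) ^ j) powr m j"
  have g0: "g $ n \<noteq> 0" for n using g_pos[of n] by simp
  have e: "(\<lambda>n. e l $ n / g $ n) \<longlonglongrightarrow> ?L"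
    using multiset_gf_mult_quotient_tendsto[of p m r l, OF p(1) m] lim r by (simp add: e_def g_def)
  then have "(\<lambda>n. e l $ (n + ?s - ?s) / g $ (n + ?s - ?s)) \<longlonglongrightarrow> ?L" by simp
  then have "(\<lambda>n. e l $ (n - ?s) / g $ (n - ?s)) \<longlonglongrightarrow> ?L" by (rule LIMSEQ_offset)
  moreover have "(\<lambda>n. g $ (n - ?s) / g $ n) \<longlonglongrightarrow> r ^ ?s"
    using lim g0 by (intro tendsto_shifted_quotient) auto
  ultimately have "(\<lambda>n. ?a * ((e l $ (n - ?s) / g $ (n - ?s)) * (g $ (n - ?s) / g $ n))) \<longlonglongrightarrow> ?a * (?L * r ^ ?s)"
    by (intro tendsto_mult tendsto_const)
  moreover have "\<forall>\<^sub>F n in sequentially. ?a * ((e l $ (n - ?s) / g $ (n - ?s)) * (g $ (n - ?s) / g $ n)) =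
      measure (conditioned n) {\<omega> \<in> space M. \<forall>j\<in>{1..l}. Z j \<omega> = k j}"
    using eventually_ge_at_top[of "l + ?s"]
    by eventually_elim (subst measure_conditioned, auto simp: g0)
  ultimately have "(\<lambda>n. measure (conditioned n) {\<omega> \<in> space M. \<forall>j\<in>{1..l}. Z j \<omega> = k j}) \<longlonglongrightarrow> ?a * (?L * r ^ ?s)"
    by (rule Lim_transform_eventually)
  also have "?a * (?L * r ^ ?s) = (\<Prod>j=1..l. neg_binomial_prob (m j) ((p * r) ^ j) (k j))"
    unfolding neg_binomial_prob_def power_sum prod.distrib[symmetric]
    by (intro prod.cong refl) (simp add: power_mult power_mult_distrib mult_ac)
  finally show ?thesis .
qed

lemma convergent_if_quotient_tendsto:
  assumes lim: "(\<lambda>n. g $ n / g $ Suc n) \<longlonglongrightarrow> r" and r: "0 \<le> r" "p * r < 1"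
  shows "convergent_structure (counting_law M Z)"
  unfolding convergent_structure_def
proof (intro allI impI)
  fix l :: nat
  \<comment> \<open>The limit law has independent negative binomial coordinates. The default
    \<open>undefined\<close> makes its support consist of extensional functions, as in the product
    space.\<close>
  define Q where "Q = Pi_pmf {1..l} undefined (\<lambda>j. embed_pmf (neg_binomial_prob (m j) ((p * r) ^ j)))"
  define R where "R k = (\<lambda>j\<in>{1..l}. real (k j))" for k :: "nat \<Rightarrow> nat"
  define \<mu> where "\<mu> = distr Q (\<Pi>\<^sub>M j\<in>{1..l}. borel) R"
  define S where "S = (\<Pi>\<^sub>E j\<in>{1..l}. (UNIV :: nat set))"
  define W where "W \<omega> = (\<lambda>j\<in>{1..l}. Z j \<omega>)" for \<omega>
  have R: "R k \<in> space (\<Pi>\<^sub>M j\<in>{1..l}. borel)" for k by (auto simp: R_def space_PiM)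
  then have R_meas: "R \<in> measurable (measure_pmf Q) (\<Pi>\<^sub>M j\<in>{1..l}. borel)" by simp
  have RW: "R (W \<omega>) = (\<lambda>j\<in>{1..l}. real (Z j \<omega>))" for \<omega>
    by (auto simp: R_def W_def)
  have S: "countable S" unfolding S_def by (intro countable_PiE) auto
  have Q: "pmf Q k = (\<Prod>j=1..l. neg_binomial_prob (m j) ((p * r) ^ j) (k j))" if "k \<in> S" for k
  proof -
    have "pmf Q k = (\<Prod>j=1..l. pmf (embed_pmf (neg_binomial_prob (m j) ((p * r) ^ j))) (k j))"
      unfolding Q_def using that by (intro pmf_Pi') (auto simp: S_def PiE_def extensional_def)
    also have "\<dots> = (\<Prod>j=1..l. neg_binomial_prob (m j) ((p * r) ^ j) (k j))"
      using p r m_pos by (intro prod.cong refl pmf_neg_binomial) (auto simp: power_less_one_iff)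
    finally show ?thesis .
  qed
  have W_eq: "{\<omega> \<in> space M. W \<omega> = k} = {\<omega> \<in> space M. \<forall>j\<in>{1..l}. Z j \<omega> = k j}" if "k \<in> S" for k
    using that by (fastforce simp: S_def W_def fun_eq_iff PiE_def extensional_def restrict_def)
  have W_meas: "W \<in> measurable (conditioned n) (count_space S)" for n
  proof (rule measurable_count_space_eq_countable[OF S, THEN iffD2], intro conjI ballI)
    show "W \<in> space (conditioned n) \<rightarrow> S" by (auto simp: W_def S_def)
    fix k assume k: "k \<in> S"
    have "(\<lambda>\<omega>. \<lambda>j\<in>{1..l}. Z j \<omega>) \<in> measurable M (\<Pi>\<^sub>M j\<in>{1..l}. count_space UNIV)"
      by (intro measurable_restrict measurable_Z) auto
    moreover have "{k} \<in> sets (\<Pi>\<^sub>M j\<in>{1..l}. count_space UNIV)"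
    proof -
      have "k \<in> extensional {1..l}" using k by (simp add: S_def PiE_def)
      then have "{k} = (\<Pi>\<^sub>E j\<in>{1..l}. {k j})" by (rule PiE_singleton[symmetric])
      also have "\<dots> \<in> sets (\<Pi>\<^sub>M j\<in>{1..l}. count_space UNIV)" by (rule sets_PiM_I_finite) auto
      finally show ?thesis .
    qed
    ultimately have "(\<lambda>\<omega>. \<lambda>j\<in>{1..l}. Z j \<omega>) -` {k} \<inter> space M \<in> events"
      by (rule measurable_sets)
    then show "W -` {k} \<inter> space (conditioned n) \<in> sets (conditioned n)"
      by (simp add: W_def[abs_def] sets_conditioned)
  qed
  show "\<exists>\<mu>. prob_space \<mu> \<and> sets \<mu> = sets (\<Pi>\<^sub>M j\<in>{1..l}. (borel :: real measure)) \<and>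
    converges_weakly (\<lambda>n. marginal_law l (counting_law M Z n)) \<mu>"
  proof (intro exI[of _ \<mu>] conjI)
    show "prob_space \<mu>"
      unfolding \<mu>_def using R_meas by (rule measure_pmf.prob_space_distr)
    show "converges_weakly (\<lambda>n. marginal_law l (counting_law M Z n)) \<mu>"
      unfolding converges_weakly_def
    proof (intro allI impI)
      fix f :: "(nat \<Rightarrow> real) \<Rightarrow> real"
      assume cont: "continuous_on (space \<mu>) f" and bdd: "bounded (f ` space \<mu>)"
      have f: "f \<in> borel_measurable (\<Pi>\<^sub>M j\<in>{1..l}. borel)"
        using cont by (intro borel_measurable_PiM_continuous) (simp add: \<mu>_def space_PiM)
      have "(\<lambda>n. \<integral>\<omega>. f (R (W \<omega>)) \<partial>conditioned n) \<longlonglongrightarrow> (\<integral>k. f (R k) \<partial>Q)"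
      proof (rule integral_tendsto_of_point_masses[where f = "\<lambda>k. f (R k)", OF S])
        show "set_pmf Q \<subseteq> S"
          unfolding Q_def S_def by (intro order_trans[OF set_Pi_pmf_subset]) (auto simp: PiE_def extensional_def)
        show "bounded ((\<lambda>k. f (R k)) ` S)"
          using R by (intro bounded_subset[OF bdd]) (auto simp: \<mu>_def)
        show "(\<lambda>n. measure (conditioned n) {\<omega> \<in> space (conditioned n). W \<omega> = k}) \<longlonglongrightarrow> pmf Q k"
          if "k \<in> S" for k
          using point_mass_tendsto[OF lim r, of l k] by (simp add: W_eq[OF that] Q[OF that])
      qed (use prob_space_conditioned W_meas in auto)
      moreover have "(\<integral>k. f (R k) \<partial>Q) = integral\<^sup>L \<mu> f"
        unfolding \<mu>_def by (rule integral_distr[OF R_meas f, symmetric])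
      \<comment> \<open>Only eventually, since the marginal on \<open>l\<close> coordinates is
        meaningful for \<open>l \<le> n\<close>.\<close>
      moreover have "\<forall>\<^sub>F n in sequentially. (\<integral>\<omega>. f (R (W \<omega>)) \<partial>conditioned n) =
          integral\<^sup>L (marginal_law l (counting_law M Z n)) f"
        using eventually_ge_at_top[of l]
        by eventually_elim (simp only: integral_marginal_counting_law[OF _ f] RW)
      ultimately show "(\<lambda>n. integral\<^sup>L (marginal_law l (counting_law M Z n)) f) \<longlonglongrightarrow> integral\<^sup>L \<mu> f"
        by (auto intro: Lim_transform_eventually)
    qed
  qed (simp add: \<mu>_def)
qed

section \<open>From a convergent structure to coefficient quotients\<close>

lemma quotient_tendsto_if_convergent:
  assumes "convergent_structure (counting_law M Z)"
  obtains r where "(\<lambda>n. g $ n / g $ Suc n) \<longlonglongrightarrow> r" "0 \<le> r" "p * r < 1"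
proof -
  obtain \<mu> where \<mu>: "prob_space \<mu>" "sets \<mu> = sets (\<Pi>\<^sub>M j\<in>{1..1}. (borel :: real measure))"
    and weak: "converges_weakly (\<lambda>n. marginal_law 1 (counting_law M Z n)) \<mu>"
    using assms unfolding convergent_structure_def by blast
  interpret \<mu>: prob_space \<mu> by (rule \<mu>(1))
  \<comment> \<open>A continuous cutoff that on integer values of \<open>x 1\<close> is exactly the
    indicator of \<open>x 1 < N\<close>. Weak convergence thus gives limits of the distribution
    function of \<open>Z 1\<close>, and differences give those of its point masses.\<close>
  define h where "h N x = max 0 (min 1 (real N - x 1))" for N :: nat and x :: "nat \<Rightarrow> real"
  have h_bounds: "0 \<le> h N x" "h N x \<le> 1" for N x by (auto simp: h_def)
  have h_cont: "continuous_on A (h N)" for A N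
    unfolding h_def
    by (intro continuous_intros continuous_on_subset[OF continuous_on_product_coordinates]) auto
  have h_meas: "h N \<in> borel_measurable (\<Pi>\<^sub>M j\<in>{1..1}. borel)" for N
    by (intro borel_measurable_PiM_continuous h_cont)
  define H where "H N = integral\<^sup>L \<mu> (h N)" for N
  define u where "u n k = measure (conditioned n) {\<omega> \<in> space M. Z 1 \<omega> = k}" for n k
  have sets_Z: "{\<omega> \<in> space M. Z 1 \<omega> \<in> K} \<in> sets (conditioned n)" for K n
    using measurable_sets[OF measurable_Z_conditioned[of 1 n], of K]
    by (simp add: vimage_def Int_def conj_commute)
  have H_lim: "(\<lambda>n. \<Sum>k<N. u n k) \<longlonglongrightarrow> H N" for N
  proof -
    have "bounded (h N ` space \<mu>)"
      using h_bounds by (intro boundedI[of _ 1]) (auto simp: abs_le_iff intro: order_trans[of _ 0])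
    then have "(\<lambda>n. integral\<^sup>L (marginal_law 1 (counting_law M Z n)) (h N)) \<longlonglongrightarrow> H N"
      using weak h_cont unfolding converges_weakly_def H_def by blast
    moreover have "\<forall>\<^sub>F n in sequentially.
        integral\<^sup>L (marginal_law 1 (counting_law M Z n)) (h N) = (\<Sum>k<N. u n k)"
      using eventually_ge_at_top[of 1]
    proof eventually_elim
      case (elim n)
      interpret cond: prob_space "conditioned n" by (rule prob_space_conditioned)
      have "integral\<^sup>L (marginal_law 1 (counting_law M Z n)) (h N) =
          (\<integral>\<omega>. h N (\<lambda>j\<in>{1..1}. real (Z j \<omega>)) \<partial>conditioned n)"
        using elim h_meas by (rule integral_marginal_counting_law)
      also have "\<dots> = (\<integral>\<omega>. indicator {\<omega> \<in> space M. Z 1 \<omega> \<in> {..<N}} \<omega> \<partial>conditioned n)"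
        by (intro Bochner_Integration.integral_cong) (auto simp: h_def indicator_def)
      also have "\<dots> = measure (conditioned n) {\<omega> \<in> space M. Z 1 \<omega> \<in> {..<N}}"
        by (auto intro!: arg_cong[of _ _ "measure _"])
      also have "{\<omega> \<in> space M. Z 1 \<omega> \<in> {..<N}} = (\<Union>k<N. {\<omega> \<in> space M. Z 1 \<omega> = k})" by auto
      also have "measure (conditioned n) \<dots> = (\<Sum>k<N. u n k)"
        unfolding u_def using sets_Z[of "{_}" n]
        by (intro cond.finite_measure_finite_Union) (auto simp: disjoint_family_on_def)
      finally show ?case .
    qed
    ultimately show ?thesis by (rule Lim_transform_eventually)
  qed
  have u_lim: "(\<lambda>n. u n k) \<longlonglongrightarrow> H (Suc k) - H k" for k
    using tendsto_diff[OF H_lim[of "Suc k"] H_lim[of k]] by simp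
  have H_0: "H 0 = 0"
    using H_lim[of 0] by (simp add: LIMSEQ_const_iff)
  have h_meas': "h N \<in> borel_measurable \<mu>" for N
    using h_meas[of N] by (simp cong: measurable_cong_sets add: \<mu>(2))
  have H_le_1: "H N \<le> 1" for N
    unfolding H_def
  proof (rule \<mu>.integral_le_const)
    show "integrable \<mu> (h N)"
      using h_bounds h_meas' by (intro \<mu>.integrable_const_bound[where B = 1]) auto
  qed (use h_bounds in auto)
  \<comment> \<open>No mass escapes to infinity because \<open>\<mu>\<close> is a probability law.
    This is the source of a nonzero \<open>s k\<close> below.\<close>
  have "(\<lambda>N. integral\<^sup>L \<mu> (h N)) \<longlonglongrightarrow> integral\<^sup>L \<mu> (\<lambda>_. 1)"
  proof (rule integral_dominated_convergence[where w = "\<lambda>_. 1"])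
    show "AE x in \<mu>. (\<lambda>N. h N x) \<longlonglongrightarrow> 1"
    proof (rule AE_I2)
      fix x :: "nat \<Rightarrow> real"
      have "\<forall>\<^sub>F N in sequentially. real N \<ge> x 1 + 1"
        using filterlim_real_sequentially by (auto simp: filterlim_at_top)
      then have "\<forall>\<^sub>F N in sequentially. h N x = 1"
        by eventually_elim (auto simp: h_def)
      then show "(\<lambda>N. h N x) \<longlonglongrightarrow> 1" by (rule tendsto_eventually)
    qed
  qed (use h_bounds h_meas' in auto)
  then have "(\<lambda>N. H N) \<longlonglongrightarrow> 1" by (simp add: H_def \<mu>.prob_space)
  then have "\<forall>\<^sub>F N in sequentially. 0 < H N" by (rule order_tendstoD) simp
  then obtain N where N: "0 < H N" by (auto simp: eventually_sequentially)
  \<comment> \<open>The coefficients of the first factor, by which the point masses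
    \<open>u n k\<close> are divided to isolate \<open>v k n\<close>.\<close>
  define a where "a k = ((m 1 + real k - 1) gchoose k) * p ^ k" for k
  have a: "p ^ k \<le> a k" for k
    using mult_right_mono[OF gbinomial_shift_ge_1[OF m[OF order_refl]], of "p ^ k" k] p by (simp add: a_def)
  have a_pos: "0 < a k" for k using a[of k] p by (smt (verit) zero_less_power)
  define v where "v k n = (if k \<le> n then e 1 $ (n - k) else 0) / g $ n" for k n
  define s where "s k = (H (Suc k) - H k) / a k" for k
  have u_eq: "u n k = a k * v k n" if "1 \<le> n" for n k
    using measure_conditioned[OF that, of "\<lambda>_. k"] by (simp add: u_def a_def v_def)
  have v_lim: "v k \<longlonglongrightarrow> s k" for k
  proof -
    have "(\<lambda>n. u n k / a k) \<longlonglongrightarrow> s k"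
      unfolding s_def using a_pos[of k] by (intro tendsto_divide u_lim) auto
    moreover have "\<forall>\<^sub>F n in sequentially. u n k / a k = v k n"
      using eventually_ge_at_top[of 1]
      by eventually_elim (use a_pos[of k] in \<open>simp add: u_eq\<close>)
    ultimately show ?thesis by (rule Lim_transform_eventually)
  qed
  have "a k * s k = H (Suc k) - H k" for k using a_pos[of k] by (simp add: s_def)
  then have H_sum: "H n = (\<Sum>k<n. a k * s k)" for n
    by (simp add: H_0 sum_lessThan_telescope)
  have s_nonneg: "0 \<le> s k" for k
    using LIMSEQ_le_const[OF u_lim[of k], of 0] a_pos[of k] by (simp add: s_def u_def)
  obtain k0 where k0: "s k0 \<noteq> 0"
  proof -
    have "\<exists>k. s k \<noteq> 0"
    proof (rule ccontr)
      assume "\<not> (\<exists>k. s k \<noteq> 0)"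
      then have "H N = 0" by (simp add: H_sum)
      with N show False by simp
    qed
    then show thesis using that by blast
  qed
  define r where "r = s (Suc k0) / s k0"
  have g0: "g $ n \<noteq> 0" for n using g_pos[of n] by simp
  \<comment> \<open>Both sides contain the same coefficient \<open>e 1 $ (n - k)\<close>, so it
    cancels in the quotient and only neighbouring coefficients of \<open>g\<close> remain.\<close>
  have v_Suc: "v (Suc k) (Suc n) = v k n * (g $ n / g $ Suc n)" for k n
    by (simp add: v_def g0)
  have lim: "(\<lambda>n. g $ n / g $ Suc n) \<longlonglongrightarrow> r"
  proof -
    have "(\<lambda>n. v (Suc k0) (Suc n) / v k0 n) \<longlonglongrightarrow> r"
      unfolding r_def using k0 by (intro tendsto_divide v_lim LIMSEQ_Suc[OF v_lim])
    moreover have "\<forall>\<^sub>F n in sequentially. v k0 n \<noteq> 0"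
      using v_lim k0 by (rule tendsto_imp_eventually_ne)
    then have "\<forall>\<^sub>F n in sequentially. v (Suc k0) (Suc n) / v k0 n = g $ n / g $ Suc n"
      by eventually_elim (simp add: v_Suc)
    ultimately show ?thesis by (rule Lim_transform_eventually)
  qed
  have r0: "0 \<le> r" using s_nonneg by (simp add: r_def)
  have s_Suc: "s (Suc k) = s k * r" for k
  proof (rule LIMSEQ_unique)
    show "(\<lambda>n. v (Suc k) (Suc n)) \<longlonglongrightarrow> s (Suc k)" by (rule LIMSEQ_Suc[OF v_lim])
    show "(\<lambda>n. v (Suc k) (Suc n)) \<longlonglongrightarrow> s k * r"
      unfolding v_Suc by (intro tendsto_mult v_lim lim)
  qed
  have s_eq: "s k = s 0 * r ^ k" for k by (induction k) (auto simp: s_Suc)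
  have "s 0 \<noteq> 0" using k0 s_eq[of k0] by auto
  then have s0: "0 < s 0" using s_nonneg[of 0] by simp
  \<comment> \<open>Otherwise every summand \<open>a k * s k\<close> is at least
    \<open>s 0 > 0\<close>, and the partial sums \<open>H n\<close> exceed their bound 1.\<close>
  have "p * r < 1"
  proof (rule ccontr)
    assume "\<not> p * r < 1"
    then have "s 0 \<le> a k * s k" for k
    proof -
      have "1 \<le> (p * r) ^ k" using \<open>\<not> p * r < 1\<close> by (intro one_le_power) simp
      then have "s 0 * 1 \<le> s 0 * (p * r) ^ k" using s0 by (intro mult_left_mono) auto
      also have "\<dots> = p ^ k * s k" by (simp add: s_eq[of k] power_mult_distrib mult_ac)
      also have "\<dots> \<le> a k * s k" using a s_nonneg by (intro mult_right_mono)
      finally show ?thesis by simp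
    qed
    then have "real n * s 0 \<le> H n" for n
      unfolding H_sum using sum_mono[of "{..<n}" "\<lambda>_. s 0"] by simp
    then have "real n * s 0 \<le> 1" for n using H_le_1[of n] order_trans by blast
    moreover obtain n where "1 / s 0 < real n" using reals_Archimedean2 by blast
    then have "1 < real n * s 0" using s0 by (simp add: field_simps)
    ultimately show False by (meson not_less)
  qed
  with lim r0 show thesis by (rule that)
qed

end

theorem proposition4:
  fixes M :: "'a measure" and Z :: "nat \<Rightarrow> 'a \<Rightarrow> nat" and m :: "nat \<Rightarrow> real" and p :: real
  assumes "0 < p" and "p < 1"
    and "\<And>j. 1 \<le> j \<Longrightarrow> 1 \<le> m j"
    and "prob_space M"
    and "prob_space.indep_vars M (\<lambda>_. count_space UNIV) Z {1..}"
    and "\<And>j k. 1 \<le> j \<Longrightarrow>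
           measure M {\<omega> \<in> space M. Z j \<omega> = k} = neg_binomial_prob (m j) (p ^ j) k"
  shows "convergent_structure (counting_law M Z) \<longleftrightarrow>
    (\<exists>\<rho> < ennreal (1 / p). fps_nth (multiset_gf p m) \<in> RT \<rho>)"
proof -
  interpret multiset_structure M Z m p
    using assms by (simp add: multiset_structure_def multiset_structure_axioms_def)
  have g0: "0 < multiset_gf p m $ n" for n using g_pos by (simp add: g_def)
  show ?thesis
  proof
    assume "convergent_structure (counting_law M Z)"
    then obtain r where r: "(\<lambda>n. g $ n / g $ Suc n) \<longlonglongrightarrow> r" "0 \<le> r" "p * r < 1"
      by (rule quotient_tendsto_if_convergent)
    have "ennreal r < ennreal (1 / p)"
      using r assms(1) by (intro ennreal_lessI) (auto simp: field_simps)
    moreover have "fps_nth (multiset_gf p m) \<in> RT (ennreal r)"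
      using r(1) less_imp_le[OF g0] less_imp_neq[OF g0] unfolding RT_def g_def
      by (auto intro!: tendsto_ennrealI dest: sym)
    ultimately show "\<exists>\<rho> < ennreal (1 / p). fps_nth (multiset_gf p m) \<in> RT \<rho>" by blast
  next
    assume "\<exists>\<rho> < ennreal (1 / p). fps_nth (multiset_gf p m) \<in> RT \<rho>"
    then obtain \<rho> where \<rho>: "\<rho> < ennreal (1 / p)" "fps_nth (multiset_gf p m) \<in> RT \<rho>" by blast
    \<comment> \<open>Being below a finite bound, \<open>\<rho>\<close> is a nonnegative
      real.\<close>
    then obtain r where r: "\<rho> = ennreal r" "0 \<le> r" by (cases \<rho>) auto
    have "(\<lambda>n. ennreal (g $ n / g $ Suc n)) \<longlonglongrightarrow> ennreal r"
      using \<rho>(2) r by (simp add: RT_def g_def)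
    then have "(\<lambda>n. g $ n / g $ Suc n) \<longlonglongrightarrow> r"
      by (rule tendsto_ennrealD) (simp_all add: r g_pos less_imp_le)
    moreover have "p * r < 1"
      using \<rho>(1) r assms(1) by (simp add: ennreal_less_iff field_simps)
    ultimately show "convergent_structure (counting_law M Z)"
      using r(2) by (intro convergent_if_quotient_tendsto)
  qed
qed

end
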